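(* Let $G$ be a non-abelian finite group. For each integer $m\ge 2$ set \[ c_m(G):=-\sum_{\substack{A\le G\ \text{abelian}\\ |G:A|=m}}\mu_2(A,G). \] Then only finitely many $c_m(G)$ are nonzero and, for every $r\ge 2$, \[ P_r(G)=\sum_{m\ge 2}\frac{c_m(G)}{m^r}. \] Consequently, \[ \mathcal P_G(z)=\sum_{m\ge 2}\frac{c_m(G)}{m(m-z)}. \] If $m_*:=|G|/m(G)$, then $c_{m_*}(G)=N_{\max}(G)$. Equivalently, the first pole (the pole of smallest modulus) of $\mathcal P_G(z)$ is at $z=m_*=|G|/m(G)$, and the coefficient of $(m_*-z)^{-1}$ in the partial-fraction expansion $\mathcal P_G(z)=\sum_{m\ge 2}\frac{c_m(G)}{m(m-z)}$ is \[ \frac{N_{\max}(G)}{m_*}=\frac{N_{\max}(G)\,m(G)}{|G|}. \]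
   Context: For a finite group $G$ and $r\ge 1$, $P_r(G):=|\mathrm{Hom}(\mathbb Z^r,G)|/|G|^r$, where $\mathrm{Hom}(\mathbb Z^r,G)$ is identified with the set of pairwise commuting $r$-tuples in $G^r$. $\mathcal P_G(z):=\sum_{r\ge 2}P_r(G)z^{r-2}$. $m(G)$ is the maximum order of an abelian subgroup of $G$, and $N_{\max}(G)$ is the number of abelian subgroups of $G$ of order $m(G)$. For non-abelian $G$, let $N_2(G)$ be the set of all abelian subgroups of $G$ and $L_2(G):=N_2(G)\cup\{G\}$, partially ordered by inclusion; $\mu_2$ denotes the Möbius function of the finite poset $L_2(G)$ (so $\mu_2(G,G)=1$ and $\sum_{X\in L_2(G),\,A\le X\le G}\mu_2(X,G)=0$ for each $A\in N_2(G)$). *)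

theory Defs
  imports "HOL-Complex_Analysis.Complex_Analysis" "HOL-Algebra.Coset"
begin

definition commuting_tuples :: "('a, 'b) monoid_scheme \<Rightarrow> nat \<Rightarrow> (nat \<Rightarrow> 'a) set" where
  "commuting_tuples G r =
     {x \<in> {..<r} \<rightarrow>\<^sub>E carrier G. \<forall>i<r. \<forall>j<r. x i \<otimes>\<^bsub>G\<^esub> x j = x j \<otimes>\<^bsub>G\<^esub> x i}"

definition commuting_prob :: "('a, 'b) monoid_scheme \<Rightarrow> nat \<Rightarrow> real" where
  "commuting_prob G r = real (card (commuting_tuples G r)) / real (Coset.order G) ^ r"

text \<open>The series \<open>\<Sum>r\<ge>2. P\<^sub>r(G) z\<^bsup>r-2\<^esup>\<close>, reindexed by \<open>n = r - 2\<close>.\<close>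

definition commuting_fps :: "('a, 'b) monoid_scheme \<Rightarrow> complex fps" where
  "commuting_fps G = Abs_fps (\<lambda>n. complex_of_real (commuting_prob G (n + 2)))"

definition abelian_subgroups :: "('a, 'b) monoid_scheme \<Rightarrow> 'a set set" where
  "abelian_subgroups G = {A. subgroup A G \<and> comm_group (G\<lparr>carrier := A\<rparr>)}"

definition max_abelian_order :: "('a, 'b) monoid_scheme \<Rightarrow> nat" where
  "max_abelian_order G = Max (card ` abelian_subgroups G)"

definition num_max_abelian :: "('a, 'b) monoid_scheme \<Rightarrow> nat" where
  "num_max_abelian G = card {A \<in> abelian_subgroups G. card A = max_abelian_order G}"

definition abelian_poset :: "('a, 'b) monoid_scheme \<Rightarrow> 'a set set" where
  "abelian_poset G = insert (carrier G) (abelian_subgroups G)"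

text \<open>
  The Moebius function of a finite subset \<open>L\<close> of a partial order, by recursion on the lower
  argument. Values outside \<open>L\<close>, or for infinite \<open>L\<close>, carry no meaning.
\<close>

function moebius_on :: "'a::order set \<Rightarrow> 'a \<Rightarrow> 'a \<Rightarrow> int" where
  "moebius_on L x y =
     (if x = y then 1
      else if finite L \<and> x < y then - (\<Sum>z\<in>{z \<in> L. x < z \<and> z \<le> y}. moebius_on L z y)
      else 0)"
  by pat_completeness auto
termination
proof (relation "Wellfounded.measure (\<lambda>(L, x, y). card {w \<in> L. x < w})", goal_cases)
  case 1
  then show ?case by simp
next
  case (2 L x y z)
  then have "{w \<in> L. z < w} \<subset> {w \<in> L. x < w}"
    by (auto dest: less_trans)
  with 2 show ?case
    by (auto intro!: psubset_card_mono)
qed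

declare moebius_on.simps [simp del]

lemma moebius_on_refl: "moebius_on L x x = 1"
  by (simp add: moebius_on.simps)

lemma sum_moebius_on_eq_0:
  assumes "finite L" "x \<in> L" "x < y"
  shows "(\<Sum>z\<in>{z \<in> L. x \<le> z \<and> z \<le> y}. moebius_on L z y) = 0"
proof -
  have "{z \<in> L. x \<le> z \<and> z \<le> y} = insert x {z \<in> L. x < z \<and> z \<le> y}"
    using assms by (auto simp: order.order_iff_strict)
  moreover have "moebius_on L x y = - (\<Sum>z\<in>{z \<in> L. x < z \<and> z \<le> y}. moebius_on L z y)"
    using assms by (subst moebius_on.simps) auto
  ultimately show ?thesis
    using assms(1) by simp
qed

definition moebius2 :: "('a, 'b) monoid_scheme \<Rightarrow> 'a set \<Rightarrow> 'a set \<Rightarrow> int" where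
  "moebius2 G = moebius_on (abelian_poset G)"

definition commuting_coeff :: "('a, 'b) monoid_scheme \<Rightarrow> nat \<Rightarrow> int" where
  "commuting_coeff G m =
     - (\<Sum>A\<in>{A \<in> abelian_subgroups G. card (rcosets\<^bsub>G\<^esub> A) = m}. moebius2 G A (carrier G))"

definition commuting_pf :: "('a, 'b) monoid_scheme \<Rightarrow> complex \<Rightarrow> complex" where
  "commuting_pf G z =
     (\<Sum>m | 2 \<le> m \<and> commuting_coeff G m \<noteq> 0.
        of_int (commuting_coeff G m) / (of_nat m * (of_nat m - z)))"

text \<open>The quotient is exact by Lagrange's theorem.\<close>

definition min_abelian_index :: "('a, 'b) monoid_scheme \<Rightarrow> nat" where
  "min_abelian_index G = Coset.order G div max_abelian_order G"

lemma max_abelian_order_dvd: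
  assumes "group G" "finite (carrier G)"
  shows "max_abelian_order G dvd Coset.order G"
proof -
  interpret group G by fact
  have "abelian_subgroups G \<subseteq> Pow (carrier G)"
    by (auto simp: abelian_subgroups_def dest: subgroup.mem_carrier)
  then have fin: "finite (abelian_subgroups G)"
    using assms(2) finite_subset by blast
  have "{\<one>\<^bsub>G\<^esub>} \<in> abelian_subgroups G"
    unfolding abelian_subgroups_def using triv_subgroup
    by (auto intro!: group.group_comm_groupI subgroup_imp_group)
  then have "max_abelian_order G \<in> card ` abelian_subgroups G"
    unfolding max_abelian_order_def using fin by (intro Max_in) auto
  then obtain A where "subgroup A G" "card A = max_abelian_order G"
    by (auto simp: abelian_subgroups_def)
  then show ?thesis
    using lagrange by (metis dvd_triv_right)
qed

end

theory Submission
  imports Defs "HOL-Algebra.Generated_Groups"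
begin

text \<open>
  A tuple of pairwise commuting elements generates an abelian subgroup \<open>B\<close>, and
  \<open>\<Sum>\<^bsub>A \<supseteq> B\<^esub> \<mu>\<^sub>2(A, G) = -1\<close> over the abelian subgroups \<open>A\<close>. Summing over all commuting tuples
  and exchanging the sums gives \<open>|Hom(\<int>\<^sup>r, G)| = - \<Sum>\<^sub>A \<mu>\<^sub>2(A, G) |A|\<^sup>r\<close>, since every tuple of
  elements of \<open>A\<close> commutes. Grouping by index yields the formula for \<open>P\<^sub>r(G)\<close>, and geometric series
  yield the partial fractions. An abelian subgroup of maximal order lies below no other proper
  element of the poset, so its Moebius value is \<open>-1\<close>. The claims about an arbitrary meromorphic
  continuation reduce to the partial fraction sum by the identity theorem.
\<close>

section \<open>Abelian subgroups and subgroups generated by commuting elements\<close>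

lemma mem_abelian_subgroups_iff:
  assumes "group G"
  shows "A \<in> abelian_subgroups G \<longleftrightarrow>
    subgroup A G \<and> (\<forall>x\<in>A. \<forall>y\<in>A. x \<otimes>\<^bsub>G\<^esub> y = y \<otimes>\<^bsub>G\<^esub> x)"
proof -
  interpret group G by fact
  show ?thesis
    unfolding abelian_subgroups_def
    using subgroup_imp_group[of A]
    by (auto intro!: group.group_comm_groupI dest: comm_groupE(4))
qed

lemma finite_abelian_subgroups:
  assumes "finite (carrier G)"
  shows "finite (abelian_subgroups G)"
proof (rule finite_subset)
  show "abelian_subgroups G \<subseteq> Pow (carrier G)"
    by (auto simp: abelian_subgroups_def dest: subgroup.mem_carrier)
qed (use assms in simp)

text \<open>The centralizer of \<open>a\<close> is a subgroup, so once it contains \<open>S\<close>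
  it contains everything that \<open>S\<close> generates.\<close>

lemma (in group) commute_generate:
  assumes "h \<in> generate G S" "S \<subseteq> carrier G" "a \<in> carrier G"
    and "\<And>s. s \<in> S \<Longrightarrow> a \<otimes> s = s \<otimes> a"
  shows "a \<otimes> h = h \<otimes> a"
  using assms(1)
proof induction
  case one
  then show ?case using assms by simp
next
  case (incl h)
  then show ?case using assms by simp
next
  case (inv h)
  then have h: "h \<in> carrier G" and *: "a \<otimes> h = h \<otimes> a"
    using assms by auto
  \<comment> \<open>Multiplying the relation for \<open>h\<close> by \<open>inv h\<close> on both
    sides leaves \<open>a \<otimes> inv h\<close> on the left and \<open>inv h \<otimes> a\<close>
    on the right.\<close>
  have "inv h \<otimes> (h \<otimes> a) \<otimes> inv h = inv h \<otimes> (a \<otimes> h) \<otimes> inv h"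
    using * by simp
  then show ?case
    using h assms(3) by (simp add: m_assoc inv_solve_left' flip: m_assoc[of "inv h" h])
next
  case (eng h1 h2)
  then have "h1 \<in> carrier G" "h2 \<in> carrier G"
    using generate_in_carrier assms(2) by auto
  then show ?case
    using eng.IH assms(3) by (metis m_assoc)
qed

lemma (in group) generate_commuting_in_abelian_subgroups:
  assumes "S \<subseteq> carrier G" "\<And>s t. s \<in> S \<Longrightarrow> t \<in> S \<Longrightarrow> s \<otimes> t = t \<otimes> s"
  shows "generate G S \<in> abelian_subgroups G"
proof -
  \<comment> \<open>The centralizer argument runs twice: first for a generator against the whole
    generated subgroup, then, with that as its input, for an arbitrary element.\<close>
  have 1: "s \<otimes> h = h \<otimes> s" if "s \<in> S" "h \<in> generate G S" for s h
    using commute_generate[OF that(2) assms(1)] that assms by blast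
  have "g \<otimes> h = h \<otimes> g" if "g \<in> generate G S" "h \<in> generate G S" for g h
    using commute_generate[OF that(2) assms(1)] 1 that generate_in_carrier[OF assms(1)] by metis
  then show ?thesis
    using generate_is_subgroup[OF assms(1)] by (simp add: mem_abelian_subgroups_iff[OF is_group])
qed

section \<open>Moebius inversion over the abelian subgroups\<close>

locale nonabelian_finite_group = group G for G (structure) +
  assumes finite_carrier: "finite (carrier G)" and nonabelian: "\<not> comm_group G"
begin

lemma finite_subgroups: "finite (abelian_subgroups G)"
  using finite_abelian_subgroups finite_carrier by blast

lemma abelian_subgroupD:
  assumes "A \<in> abelian_subgroups G"
  shows "subgroup A G" "A \<subset> carrier G" "finite A" "A \<noteq> {}"
proof -
  show 1: "subgroup A G"
    using assms by (simp add: abelian_subgroups_def)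
  have "A \<noteq> carrier G"
    using assms nonabelian by (auto simp: abelian_subgroups_def)
  with subgroup.subset[OF 1] show "A \<subset> carrier G" by blast
  then show "finite A"
    using finite_carrier finite_subset by blast
  show "A \<noteq> {}"
    using subgroup.one_closed[OF 1] by blast
qed

text \<open>Lagrange's theorem with the nonzero factor \<open>card A\<close> cancelled; it trades
  indices for orders without any division of natural numbers.\<close>

lemma index_eq_iff:
  assumes "A \<in> abelian_subgroups G"
  shows "card (rcosets A) = m \<longleftrightarrow> m * card A = order G"
  using lagrange[OF abelian_subgroupD(1)[OF assms]] abelian_subgroupD(3,4)[OF assms]
  by (metis card_gt_0_iff mult_right_cancel less_irrefl)

text \<open>An abelian subgroup of a non-abelian group is proper. This is why the sums over
  \<open>m\<close> can start at 2.\<close>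

lemma index_ge_2:
  assumes "A \<in> abelian_subgroups G"
  shows "2 \<le> card (rcosets A)"
proof -
  have "card A < order G"
    using psubset_card_mono[OF finite_carrier abelian_subgroupD(2)[OF assms]]
    by (simp add: order_def)
  then have "card (rcosets A) \<noteq> 0" "card (rcosets A) \<noteq> 1"
    using index_eq_iff[OF assms] by auto
  then show ?thesis by linarith
qed

text \<open>The Moebius values over the interval from \<open>B\<close> to the top add up to 0, and
  the top, which is not itself abelian, contributes 1.\<close>

lemma sum_moebius2_above:
  assumes "B \<in> abelian_subgroups G"
  shows "(\<Sum>A | A \<in> abelian_subgroups G \<and> B \<subseteq> A. moebius2 G A (carrier G)) = -1"
proof -
  have "{X \<in> abelian_poset G. B \<le> X \<and> X \<le> carrier G}
      = insert (carrier G) {A. A \<in> abelian_subgroups G \<and> B \<subseteq> A}"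
    using assms abelian_subgroupD(2) by (auto simp: abelian_poset_def)
  moreover have "(\<Sum>X\<in>{X \<in> abelian_poset G. B \<le> X \<and> X \<le> carrier G}.
      moebius_on (abelian_poset G) X (carrier G)) = 0"
    using assms abelian_subgroupD(2) finite_subgroups
    by (intro sum_moebius_on_eq_0) (auto simp: abelian_poset_def)
  moreover have "carrier G \<notin> {A. A \<in> abelian_subgroups G \<and> B \<subseteq> A}"
    using abelian_subgroupD(2) by blast
  ultimately show ?thesis
    using finite_subgroups by (simp add: moebius2_def moebius_on_refl)
qed

lemma card_commuting_tuples:
  "int (card (commuting_tuples G r)) =
     - (\<Sum>A\<in>abelian_subgroups G. moebius2 G A (carrier G) * int (card A) ^ r)"
proof -
  let ?N = "abelian_subgroups G" and ?C = "commuting_tuples G r"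
  have finC: "finite ?C"
    by (rule finite_subset[of _ "{..<r} \<rightarrow>\<^sub>E carrier G"])
      (auto simp: commuting_tuples_def finite_carrier intro!: finite_PiE)
  have tuples: "{x \<in> ?C. x ` {..<r} \<subseteq> A} = {..<r} \<rightarrow>\<^sub>E A" if "A \<in> ?N" for A
  proof -
    have "A \<subseteq> carrier G" and comm: "\<And>a b. a \<in> A \<Longrightarrow> b \<in> A \<Longrightarrow> a \<otimes> b = b \<otimes> a"
      using that abelian_subgroupD(2)[OF that]
      by (auto simp: mem_abelian_subgroups_iff[OF is_group])
    then show ?thesis
      by (auto simp: commuting_tuples_def PiE_iff image_subset_iff extensional_def)
  qed
  have above: "(\<Sum>A\<in>{A \<in> ?N. x ` {..<r} \<subseteq> A}. moebius2 G A (carrier G)) = -1" if "x \<in> ?C" for x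
  proof -
    have sub: "x ` {..<r} \<subseteq> carrier G"
      using that by (auto simp: commuting_tuples_def)
    have "generate G (x ` {..<r}) \<in> ?N"
      using that sub
      by (intro generate_commuting_in_abelian_subgroups) (auto simp: commuting_tuples_def)
    moreover
    \<comment> \<open>A subgroup contains the entries of \<open>x\<close> exactly when it contains
      the subgroup they generate, so the abelian subgroups over the tuple form the upper set of one
      element of the poset.\<close>
    have "x ` {..<r} \<subseteq> A \<longleftrightarrow> generate G (x ` {..<r}) \<subseteq> A" if "A \<in> ?N" for A
    proof
      assume "x ` {..<r} \<subseteq> A"
      then show "generate G (x ` {..<r}) \<subseteq> A"
        using abelian_subgroupD(1)[OF that] by (rule generate_subgroup_incl)
    next
      assume "generate G (x ` {..<r}) \<subseteq> A"
      then show "x ` {..<r} \<subseteq> A"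
        using generate.incl[of _ "x ` {..<r}" G] by (meson subset_iff)
    qed
    then have "{A \<in> ?N. x ` {..<r} \<subseteq> A} = {A. A \<in> ?N \<and> generate G (x ` {..<r}) \<subseteq> A}"
      by (intro Collect_cong conj_cong refl)
    ultimately show ?thesis
      using sum_moebius2_above[of "generate G (x ` {..<r})"] by simp
  qed
  \<comment> \<open>The power \<open>card A ^ r\<close> is read as the number of commuting tuples
    with entries in \<open>A\<close>, which makes the double sum over pairs of a tuple and a
    subgroup visible.\<close>
  have "(\<Sum>A\<in>?N. moebius2 G A (carrier G) * int (card A) ^ r)
      = (\<Sum>A\<in>?N. \<Sum>x\<in>{x \<in> ?C. x ` {..<r} \<subseteq> A}. moebius2 G A (carrier G))"
    by (rule sum.cong) (simp_all add: tuples card_PiE)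
  also have "\<dots> = (\<Sum>x\<in>?C. \<Sum>A\<in>{A \<in> ?N. x ` {..<r} \<subseteq> A}. moebius2 G A (carrier G))"
    by (rule sum.swap_restrict[OF finite_subgroups finC])
  also have "\<dots> = - int (card ?C)"
    by (simp add: above)
  finally show ?thesis by simp
qed

text \<open>If \<open>m\<close> is not the index of an abelian subgroup, the sum defining the
  coefficient is empty. As there are finitely many such subgroups, the support is finite.\<close>

lemma commuting_coeff_support:
  assumes "commuting_coeff G m \<noteq> 0"
  shows "m \<in> (\<lambda>A. card (rcosets A)) ` abelian_subgroups G"
proof (rule ccontr)
  assume "\<not> ?thesis"
  then have "{A \<in> abelian_subgroups G. card (rcosets A) = m} = {}" by auto
  with assms show False
    unfolding commuting_coeff_def by simp
qed

lemma finite_coeff_support: "finite {m. 2 \<le> m \<and> commuting_coeff G m \<noteq> 0}"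
  by (rule finite_subset[OF _ finite_imageI[OF finite_subgroups]])
    (use commuting_coeff_support in blast)

lemma commuting_prob_eq:
  "commuting_prob G r =
     (\<Sum>m | 2 \<le> m \<and> commuting_coeff G m \<noteq> 0. real_of_int (commuting_coeff G m) / real m ^ r)"
proof -
  let ?N = "abelian_subgroups G" and ?i = "\<lambda>A. card (rcosets A)"
  let ?mu = "\<lambda>A. real_of_int (moebius2 G A (carrier G))"
  have frac: "real (card A) / real (order G) = 1 / real (?i A)" if "A \<in> ?N" for A
  proof -
    have "real (?i A) * real (card A) = real (order G)"
      using index_eq_iff[OF that, of "?i A"] by (metis of_nat_mult)
    moreover have "real (card A) > 0"
      using abelian_subgroupD(3,4)[OF that] by (simp add: card_gt_0_iff)
    moreover have "real (?i A) > 0"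
      using index_ge_2[OF that] by simp
    ultimately show ?thesis
      by (simp add: divide_simps flip: \<open>real (?i A) * real (card A) = real (order G)\<close>)
  qed
  have "commuting_prob G r = real_of_int (int (card (commuting_tuples G r))) / real (order G) ^ r"
    by (simp add: commuting_prob_def)
  also have "\<dots> = - (\<Sum>A\<in>?N. ?mu A * (real (card A) / real (order G)) ^ r)"
    unfolding card_commuting_tuples by (simp add: sum_divide_distrib power_divide)
  also have "\<dots> = - (\<Sum>A\<in>?N. ?mu A / real (?i A) ^ r)"
    by (simp add: frac power_divide)
  \<comment> \<open>The subgroups are grouped into the fibres of the index map.\<close>
  also have "\<dots> = - (\<Sum>m\<in>?i ` ?N. \<Sum>A\<in>{A \<in> ?N. ?i A = m}. ?mu A / real (?i A) ^ r)"
    by (subst sum.image_gen[OF finite_subgroups, where g = ?i]) simp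
  also have "\<dots> = (\<Sum>m\<in>?i ` ?N. real_of_int (commuting_coeff G m) / real m ^ r)"
    by (simp add: commuting_coeff_def sum_negf sum_divide_distrib flip: sum_negf)
  \<comment> \<open>Indices whose Moebius values cancel are dropped; the remaining ones are exactly
    the support, since every index is at least 2.\<close>
  also have "\<dots> = (\<Sum>m | 2 \<le> m \<and> commuting_coeff G m \<noteq> 0.
      real_of_int (commuting_coeff G m) / real m ^ r)"
    by (rule sum.mono_neutral_right)
      (use finite_subgroups commuting_coeff_support index_ge_2 in auto)
  finally show ?thesis .
qed

section \<open>Abelian subgroups of maximal order\<close>

lemma max_abelian_order:
  shows "max_abelian_order G > 0"
    and "A \<in> abelian_subgroups G \<Longrightarrow> card A \<le> max_abelian_order G"
    and "\<exists>A\<in>abelian_subgroups G. card A = max_abelian_order G"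
proof -
  show le: "card A \<le> max_abelian_order G" if "A \<in> abelian_subgroups G" for A
    using that finite_subgroups by (auto simp: max_abelian_order_def)
  \<comment> \<open>The trivial subgroup shows that the maximum is taken over a nonempty
    set.\<close>
  have "generate G {} \<in> abelian_subgroups G"
    by (rule generate_commuting_in_abelian_subgroups) auto
  then have "max_abelian_order G \<in> card ` abelian_subgroups G"
    unfolding max_abelian_order_def using finite_subgroups by (intro Max_in) auto
  then show "\<exists>A\<in>abelian_subgroups G. card A = max_abelian_order G" by auto
  then show "max_abelian_order G > 0"
    using abelian_subgroupD(3,4) by (metis card_gt_0_iff)
qed

lemma min_index_mult: "min_abelian_index G * max_abelian_order G = order G"
  using max_abelian_order_dvd[OF is_group finite_carrier] by (simp add: min_abelian_index_def)

lemma min_index_ge_2: "2 \<le> min_abelian_index G"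
proof -
  obtain A where A: "A \<in> abelian_subgroups G" "card A = max_abelian_order G"
    using max_abelian_order(3) by blast
  then have "card (rcosets A) = min_abelian_index G"
    using index_eq_iff min_index_mult by simp
  then show ?thesis
    using index_ge_2[OF A(1)] by simp
qed

text \<open>Such an \<open>m\<close> is the index of an abelian subgroup, whose order is at most the
  maximal one. The bound controls both the radius of convergence and the position of the other
  poles.\<close>

lemma min_index_le:
  assumes "commuting_coeff G m \<noteq> 0"
  shows "min_abelian_index G \<le> m"
proof -
  obtain A where A: "A \<in> abelian_subgroups G" "m * card A = order G"
    using commuting_coeff_support[OF assms] index_eq_iff by blast
  then have "min_abelian_index G * max_abelian_order G \<le> m * max_abelian_order G"
    using max_abelian_order(2)[OF A(1)] min_index_mult by (metis mult_le_mono2)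
  then show ?thesis
    using max_abelian_order(1) by simp
qed

lemma commuting_coeff_min_index:
  "commuting_coeff G (min_abelian_index G) = int (num_max_abelian G)"
proof -
  \<comment> \<open>Index times order is constant, so the minimal index singles out the subgroups of
    maximal order.\<close>
  have "{A \<in> abelian_subgroups G. card (rcosets A) = min_abelian_index G}
      = {A \<in> abelian_subgroups G. card A = max_abelian_order G}"
    using index_eq_iff min_index_mult min_index_ge_2
    by (metis (no_types, lifting) mult_left_cancel not_numeral_le_zero)
  moreover have "moebius2 G A (carrier G) = -1"
    if "A \<in> abelian_subgroups G" "card A = max_abelian_order G" for A
  proof -
    have "B = A" if "B \<in> abelian_subgroups G" "A \<subseteq> B" for B
      using that max_abelian_order(2)[OF that(1)] \<open>card A = _\<close> abelian_subgroupD(3)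
      by (metis card_seteq)
    then have "{B. B \<in> abelian_subgroups G \<and> A \<subseteq> B} = {A}"
      using that by auto
    then show ?thesis
      using sum_moebius2_above[OF that(1)] by simp
  qed
  ultimately show ?thesis
    by (simp add: commuting_coeff_def num_max_abelian_def)
qed

lemma num_max_abelian_pos: "num_max_abelian G > 0"
  using max_abelian_order(3) finite_subgroups
  by (auto simp: num_max_abelian_def card_gt_0_iff)

end

section \<open>Partial fractions and uniqueness of meromorphic continuation\<close>

lemma
  fixes a p :: "'i \<Rightarrow> complex"
  assumes "finite S" "inj_on p S" "k \<in> S"
  shows is_pole_partial_fractions: "a k \<noteq> 0 \<Longrightarrow> is_pole (\<lambda>z. \<Sum>i\<in>S. a i / (p i - z)) (p k)"
    and residue_partial_fractions: "residue (\<lambda>z. \<Sum>i\<in>S. a i / (p i - z)) (p k) = - a k"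
proof -
  \<comment> \<open>This is the sum multiplied by \<open>z - p k\<close>, with the singularity at
    \<open>p k\<close> removed. The sign of \<open>a k\<close> comes from the denominators being
    \<open>p i - z\<close> rather than \<open>z - p i\<close>.\<close>
  define h where "h z = (\<Sum>i\<in>S-{k}. a i / (p i - z)) * (z - p k) - a k" for z
  define U where "U = - (p ` (S - {k}))"
  have U: "open U" "p k \<in> U"
    unfolding U_def using assms by (auto intro!: finite_imp_closed open_Compl dest: inj_onD)
  have hol: "h holomorphic_on U"
    unfolding h_def U_def by (intro holomorphic_intros) auto
  \<comment> \<open>The identity holds for all \<open>z \<noteq> p k\<close>, even at the other
    poles, because the summands with a zero denominator have the value 0 on both sides.\<close>
  have ev: "eventually (\<lambda>z. (\<Sum>i\<in>S. a i / (p i - z)) = h z / (z - p k)) (at (p k))"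
    unfolding eventually_at_filter
  proof (intro always_eventually allI impI)
    fix z assume "z \<noteq> p k"
    then have "h z / (z - p k) = a k / (p k - z) + (\<Sum>i\<in>S-{k}. a i / (p i - z))"
      by (simp add: h_def divide_simps) (simp add: algebra_simps)
    then show "(\<Sum>i\<in>S. a i / (p i - z)) = h z / (z - p k)"
      using assms by (simp add: sum.remove)
  qed
  have "h (p k) = - a k" by (simp add: h_def)
  then show "residue (\<lambda>z. \<Sum>i\<in>S. a i / (p i - z)) (p k) = - a k"
    using residue_cong[OF ev refl] residue_simple[OF U hol] by simp
  show "is_pole (\<lambda>z. \<Sum>i\<in>S. a i / (p i - z)) (p k)" if "a k \<noteq> 0"
    using is_pole_cong[OF ev refl] is_pole_basic[OF hol U, of 1] \<open>h (p k) = - a k\<close> that by simp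
qed

lemma not_is_pole_partial_fractions:
  fixes a p :: "'i \<Rightarrow> complex"
  assumes "finite S" "w \<notin> p ` S"
  shows "\<not> is_pole (\<lambda>z. \<Sum>i\<in>S. a i / (p i - z)) w"
proof (rule not_is_pole_holomorphic)
  show "open (- (p ` S))"
    using assms by (intro open_Compl finite_imp_closed) auto
  show "(\<lambda>z. \<Sum>i\<in>S. a i / (p i - z)) holomorphic_on - (p ` S)"
    by (intro holomorphic_intros) auto
qed (use assms in auto)

text \<open>The difference of the two functions either vanishes or avoids 0 off a sparse set, and
  agreement near 0 excludes the latter. The conclusion concerns punctured neighbourhoods because
  meromorphic functions may take arbitrary values at isolated points; poles and residues do not see
  those values.\<close>

lemma meromorphic_fps_expansion_unique:
  assumes "f meromorphic_on UNIV" "g meromorphic_on UNIV"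
    and "f has_fps_expansion F" "g has_fps_expansion F"
  shows "eventually (\<lambda>z. f z = g z) (at w)"
proof -
  have nhds: "eventually (\<lambda>z. f z = g z) (nhds 0)"
    using assms(3,4) unfolding has_fps_expansion_def by (auto elim: eventually_elim2)
  have "(\<lambda>z. f z - g z) meromorphic_on UNIV"
    using assms by (intro meromorphic_intros)
  then have "eventually (\<lambda>z. f z - g z = 0) (cosparse UNIV) \<or>
      eventually (\<lambda>z. f z - g z \<noteq> 0) (cosparse UNIV)"
    by (intro meromorphic_imp_constant_or_avoid) auto
  moreover have "\<not> eventually (\<lambda>z. f z - g z \<noteq> 0) (cosparse UNIV)"
  proof
    assume "eventually (\<lambda>z. f z - g z \<noteq> 0) (cosparse UNIV)"
    then have "eventually (\<lambda>z. f z - g z \<noteq> 0) (at 0)"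
      by (auto simp: eventually_cosparse_open_eq)
    moreover have "eventually (\<lambda>z. f z = g z) (at 0)"
      using nhds by (auto simp: eventually_at_filter elim: eventually_mono)
    ultimately have "eventually (\<lambda>z::complex. False) (at 0)"
      by eventually_elim simp
    then show False by simp
  qed
  ultimately show ?thesis
    by (auto simp: eventually_cosparse_open_eq)
qed

section \<open>The generating function and its first pole\<close>

context nonabelian_finite_group
begin

text \<open>Brings the summands into the shape \<open>a i / (p i - z)\<close> of the partial
  fraction lemmas, so that the coefficient of \<open>1 / (m - z)\<close> can be read off.\<close>

lemma commuting_pf_eq:
  "commuting_pf G = (\<lambda>z. \<Sum>m | 2 \<le> m \<and> commuting_coeff G m \<noteq> 0.
     of_int (commuting_coeff G m) / of_nat m / (of_nat m - z))"
  by (simp add: commuting_pf_def fun_eq_iff)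

lemma commuting_pf_meromorphic: "commuting_pf G meromorphic_on UNIV"
  unfolding commuting_pf_eq by (intro meromorphic_intros)

text \<open>Each summand is a geometric series in \<open>z / m\<close>. It converges because no
  \<open>m\<close> in the support lies below the minimal index.\<close>

lemma commuting_fps_sums:
  assumes "norm z < real (min_abelian_index G)"
  shows "(\<lambda>n. fps_nth (commuting_fps G) n * z ^ n) sums commuting_pf G z"
proof -
  let ?S = "{m. 2 \<le> m \<and> commuting_coeff G m \<noteq> 0}"
  let ?c = "\<lambda>m. of_int (commuting_coeff G m) :: complex"
  \<comment> \<open>The factor \<open>1 / m ^ 2\<close> comes from the shift
    \<open>r = n + 2\<close>.\<close>
  have "(\<lambda>n. \<Sum>m\<in>?S. ?c m / of_nat m ^ 2 * (z / of_nat m) ^ n) sums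
      (\<Sum>m\<in>?S. ?c m / of_nat m ^ 2 * (1 / (1 - z / of_nat m)))"
  proof (intro sums_sum sums_mult geometric_sums)
    fix m assume "m \<in> ?S"
    then have "norm z < real m" "m > 0"
      using min_index_le[of m] assms by auto
    then show "norm (z / of_nat m) < 1"
      by (simp add: norm_divide)
  qed
  moreover have "(\<Sum>m\<in>?S. ?c m / of_nat m ^ 2 * (z / of_nat m) ^ n)
      = fps_nth (commuting_fps G) n * z ^ n" for n
    by (simp add: commuting_fps_def commuting_prob_eq sum_distrib_left power_add
        power_divide mult_ac power2_eq_square)
  moreover have "(\<Sum>m\<in>?S. ?c m / of_nat m ^ 2 * (1 / (1 - z / of_nat m))) = commuting_pf G z"
    unfolding commuting_pf_def
  proof (rule sum.cong)
    fix m assume "m \<in> ?S"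
    then have "(of_nat m :: complex) \<noteq> 0" "of_nat m \<noteq> z"
      using min_index_le[of m] assms by auto
    then show "?c m / of_nat m ^ 2 * (1 / (1 - z / of_nat m)) = ?c m / (of_nat m * (of_nat m - z))"
      by (simp add: divide_simps power2_eq_square)
  qed simp
  ultimately show ?thesis by simp
qed

lemma commuting_pf_has_fps_expansion: "commuting_pf G has_fps_expansion commuting_fps G"
proof (rule has_fps_expansionI)
  have "eventually (\<lambda>z::complex. z \<in> ball 0 (real (min_abelian_index G))) (nhds 0)"
    using min_index_ge_2 by (intro eventually_nhds_in_open) auto
  then show "eventually (\<lambda>z. (\<lambda>n. fps_nth (commuting_fps G) n * z ^ n) sums commuting_pf G z) (nhds 0)"
    by eventually_elim (simp add: commuting_fps_sums)
qed

lemma commuting_pf_first_pole: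
  shows "is_pole (commuting_pf G) (of_nat (min_abelian_index G))"
    and "is_pole (commuting_pf G) w \<Longrightarrow> w \<noteq> of_nat (min_abelian_index G) \<Longrightarrow>
           real (min_abelian_index G) < norm w"
    and "residue (commuting_pf G) (of_nat (min_abelian_index G)) =
           - (of_nat (num_max_abelian G) / of_nat (min_abelian_index G))"
proof -
  let ?S = "{m. 2 \<le> m \<and> commuting_coeff G m \<noteq> 0}"
  \<comment> \<open>The coefficient there counts the abelian subgroups of maximal order, so it is
    positive and no cancellation can remove the pole.\<close>
  have mem: "min_abelian_index G \<in> ?S"
    using min_index_ge_2 num_max_abelian_pos by (simp add: commuting_coeff_min_index)
  have inj: "inj_on (of_nat :: nat \<Rightarrow> complex) ?S"
    by (simp add: inj_on_def)
  show "is_pole (commuting_pf G) (of_nat (min_abelian_index G))"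
    unfolding commuting_pf_eq using mem
    by (intro is_pole_partial_fractions[OF finite_coeff_support inj]) auto
  show "residue (commuting_pf G) (of_nat (min_abelian_index G)) =
      - (of_nat (num_max_abelian G) / of_nat (min_abelian_index G))"
    unfolding commuting_pf_eq residue_partial_fractions[OF finite_coeff_support inj mem]
    by (simp add: commuting_coeff_min_index)
  assume "is_pole (commuting_pf G) w" "w \<noteq> of_nat (min_abelian_index G)"
  moreover from this have "w \<in> of_nat ` ?S"
    using not_is_pole_partial_fractions[OF finite_coeff_support, of w of_nat
        "\<lambda>m. of_int (commuting_coeff G m) / of_nat m"]
    unfolding commuting_pf_eq by metis
  ultimately obtain m where "m \<in> ?S" "w = of_nat m" "m \<noteq> min_abelian_index G"
    by auto
  then show "real (min_abelian_index G) < norm w"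
    using min_index_le[of m] by simp
qed

end

theorem theorem4p18:
  fixes G :: "('a, 'b) monoid_scheme"
  assumes "group G" and "finite (carrier G)" and "\<not> comm_group G"
  shows "finite {m. 2 \<le> m \<and> commuting_coeff G m \<noteq> 0}
    \<and> (\<forall>r\<ge>2. commuting_prob G r =
          (\<Sum>m | 2 \<le> m \<and> commuting_coeff G m \<noteq> 0. real_of_int (commuting_coeff G m) / real m ^ r))
    \<and> commuting_pf G meromorphic_on UNIV
    \<and> commuting_pf G has_fps_expansion commuting_fps G
    \<and> (\<forall>z. norm z < real (min_abelian_index G) \<longrightarrow>
          (\<lambda>n. fps_nth (commuting_fps G) n * z ^ n) sums commuting_pf G z)
    \<and> commuting_coeff G (min_abelian_index G) = int (num_max_abelian G)
    \<and> (\<forall>f. f meromorphic_on UNIV \<and> f has_fps_expansion commuting_fps G \<longrightarrow>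
          is_pole f (of_nat (min_abelian_index G))
          \<and> (\<forall>w. is_pole f w \<and> w \<noteq> of_nat (min_abelian_index G) \<longrightarrow>
                real (min_abelian_index G) < norm w)
          \<and> residue f (of_nat (min_abelian_index G)) =
              - (of_nat (num_max_abelian G) / of_nat (min_abelian_index G)))
    \<and> real_of_int (commuting_coeff G (min_abelian_index G)) / real (min_abelian_index G) =
          real (num_max_abelian G) / real (min_abelian_index G)
    \<and> real (num_max_abelian G) / real (min_abelian_index G) =
          real (num_max_abelian G) * real (max_abelian_order G) / real (Coset.order G)"
proof -
  interpret nonabelian_finite_group G
    using assms by (simp add: nonabelian_finite_group_def nonabelian_finite_group_axioms_def)
  have poles: "is_pole f (of_nat (min_abelian_index G))
      \<and> (\<forall>w. is_pole f w \<and> w \<noteq> of_nat (min_abelian_index G) \<longrightarrow>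
            real (min_abelian_index G) < norm w)
      \<and> residue f (of_nat (min_abelian_index G)) =
          - (of_nat (num_max_abelian G) / of_nat (min_abelian_index G))"
    if f: "f meromorphic_on UNIV" "f has_fps_expansion commuting_fps G" for f
  proof -
    \<comment> \<open>Agreement near every \<open>w\<close>, not only near 0, transfers all the
      poles as well as the residue.\<close>
    have ev: "eventually (\<lambda>z. f z = commuting_pf G z) (at w)" for w
      using meromorphic_fps_expansion_unique[OF f(1) commuting_pf_meromorphic f(2)
          commuting_pf_has_fps_expansion] .
    show ?thesis
      using commuting_pf_first_pole by (simp add: is_pole_cong[OF ev refl] residue_cong[OF ev refl])
  qed
  have quotient: "real (num_max_abelian G) / real (min_abelian_index G) =
      real (num_max_abelian G) * real (max_abelian_order G) / real (Coset.order G)"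
    using max_abelian_order(1) min_index_ge_2 by (simp flip: min_index_mult)
  show ?thesis
    using finite_coeff_support commuting_prob_eq commuting_pf_meromorphic
      commuting_pf_has_fps_expansion commuting_fps_sums commuting_coeff_min_index poles quotient
    by (intro conjI allI impI) auto
qed

end
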